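(* Let $d \ge 1$ and $m \ge 0$, and let $\ell_1,\dots,\ell_m \in H_1(\mathbb{C}^2)$ be fixed, pairwise non-proportional linear forms. Let $r \ge 0$ and let $e_1,\dots,e_r$ be positive integers with $e_k \mid d$ for each $k$ and $d > e_1 \ge e_2 \ge \cdots \ge e_r$. Suppose further that $$m + \sum_{k=1}^r (e_k+1) = d+1.$$ Then a general binary form $p \in H_d(\mathbb{C}^2)$ can be written as $$p(x,y) = \sum_{j=1}^m t_j\,\ell_j(x,y)^d + \sum_{k=1}^r f_k(x,y)^{d/e_k},$$ with $t_j \in \mathbb{C}$ and $f_k \in H_{e_k}(\mathbb{C}^2)$.
   Context: $H_d(\mathbb{C}^n)$ denotes the complex vector space of homogeneous polynomials of degree $d$ in $n$ variables. "A general $p$ has property P" means P holds for all $p$ in a nonempty Zariski-open subset of $H_d(\mathbb{C}^n)$. *)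

theory Defs
  imports Complex_Main
begin

text \<open>A binary form of degree d is represented by its coefficient vector
  a :: nat => complex (coefficients a 0, ..., a d; entries beyond d are ignored/zero):
  p(x,y) = sum_{i<=d} a i * x^i * y^(d-i).\<close>

definition bform :: "nat \<Rightarrow> (nat \<Rightarrow> complex) \<Rightarrow> complex \<Rightarrow> complex \<Rightarrow> complex" where
  "bform d a x y = (\<Sum>i\<le>d. a i * x ^ i * y ^ (d - i))"

definition coeff_space :: "nat \<Rightarrow> (nat \<Rightarrow> complex) set" where
  "coeff_space d = {a. \<forall>i>d. a i = 0}"

inductive_set poly_fun :: "nat \<Rightarrow> ((nat \<Rightarrow> complex) \<Rightarrow> complex) set" for n :: nat where
  const: "(\<lambda>a. c) \<in> poly_fun n"
| coord: "i < n \<Longrightarrow> (\<lambda>a. a i) \<in> poly_fun n"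
| add: "f \<in> poly_fun n \<Longrightarrow> g \<in> poly_fun n \<Longrightarrow> (\<lambda>a. f a + g a) \<in> poly_fun n"
| mult: "f \<in> poly_fun n \<Longrightarrow> g \<in> poly_fun n \<Longrightarrow> (\<lambda>a. f a * g a) \<in> poly_fun n"

definition zariski_open_forms :: "nat \<Rightarrow> (nat \<Rightarrow> complex) set \<Rightarrow> bool" where
  "zariski_open_forms d U \<longleftrightarrow> U \<subseteq> coeff_space d \<and>
     (\<exists>S \<subseteq> poly_fun (Suc d). U = {a \<in> coeff_space d. \<exists>g\<in>S. g a \<noteq> 0})"

definition general_form :: "nat \<Rightarrow> ((nat \<Rightarrow> complex) \<Rightarrow> bool) \<Rightarrow> bool" where
  "general_form d P \<longleftrightarrow> (\<exists>U. zariski_open_forms d U \<and> U \<noteq> {} \<and> (\<forall>a\<in>U. P a))"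

end

theory Submission
  imports Defs "HOL-Computational_Algebra.Computational_Algebra"
begin

text \<open>The right-hand side is a polynomial map from a space of dimension
  \<open>m + (\<Sum>k<r. e k + 1) = d + 1\<close> to the space of forms. By elimination of variables over the complex
  numbers its image is constructible, so either the image or its complement contains a nonempty
  principal open set, and it suffices to show that the image is Zariski dense. This follows from
  surjectivity of the differential at one point. At \<open>f\<^sub>k = \<lambda>\<^sub>k ^ e\<^sub>k\<close>, with linear forms \<open>\<lambda>\<^sub>k\<close> that are
  pairwise non-proportional and not proportional to any \<open>\<ell>\<^sub>j\<close>, the image of the differential is the sum
  of the lines spanned by \<open>\<ell>\<^sub>j ^ d\<close> and of the spaces of multiples of \<open>\<lambda>\<^sub>k ^ (d - e\<^sub>k)\<close>. A functional \<open>\<phi>\<close>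
  killing this sum gives a form \<open>\<lambda> \<mapsto> \<phi> (\<lambda> ^ d)\<close> of degree \<open>d\<close> with a zero at each \<open>\<ell>\<^sub>j\<close> and a zero of order
  \<open>e\<^sub>k + 1\<close> at each \<open>\<lambda>\<^sub>k\<close>, hence with \<open>d + 1\<close> zeros, so \<open>\<phi> = 0\<close>. Binary forms are handled as
  univariate polynomials by setting \<open>y = 1\<close>.\<close>

section \<open>Polynomial functions and families of univariate polynomials\<close>

lemma poly_fun_diff:
  assumes "f \<in> poly_fun n" "g \<in> poly_fun n"
  shows "(\<lambda>a. f a - g a) \<in> poly_fun n"
  using poly_fun.add[OF assms(1) poly_fun.mult[OF poly_fun.const[of "-1"] assms(2)]] by simp

lemma poly_fun_sum:
  assumes "\<And>i. i \<in> A \<Longrightarrow> f i \<in> poly_fun n"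
  shows "(\<lambda>a. \<Sum>i\<in>A. f i a) \<in> poly_fun n"
  using assms
proof (induction A rule: infinite_finite_induct)
  case (insert x F)
  then show ?case by (simp add: poly_fun.add)
qed (simp_all add: poly_fun.const)

lemma poly_fun_cong:
  assumes "f \<in> poly_fun n" "\<And>i. i < n \<Longrightarrow> a i = b i"
  shows "f a = f b"
  using assms by (induction) auto

lemma poly_fun_tendsto:
  assumes "f \<in> poly_fun n" "\<And>i. i < n \<Longrightarrow> ((\<lambda>s. y s i) \<longlongrightarrow> z i) F"
  shows "((\<lambda>s. f (y s)) \<longlongrightarrow> f z) F"
  using assms by (induction) (auto intro: tendsto_intros)

text \<open>\<open>D\<close> is a strict bound for the degrees, so that \<open>D = 0\<close> means the zero family.\<close>

definition poly_fam :: "nat \<Rightarrow> nat \<Rightarrow> ((nat \<Rightarrow> complex) \<Rightarrow> complex poly) set" where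
  "poly_fam n D = {p. (\<forall>i. (\<lambda>a. coeff (p a) i) \<in> poly_fun n) \<and> (\<forall>a i. D \<le> i \<longrightarrow> coeff (p a) i = 0)}"

lemma poly_fam_coeff: "p \<in> poly_fam n D \<Longrightarrow> (\<lambda>a. coeff (p a) i) \<in> poly_fun n"
  by (simp add: poly_fam_def)

lemma poly_fam_coeff_eq_0: "p \<in> poly_fam n D \<Longrightarrow> D \<le> i \<Longrightarrow> coeff (p a) i = 0"
  by (simp add: poly_fam_def)

lemma poly_fam_mono: "p \<in> poly_fam n D \<Longrightarrow> D \<le> E \<Longrightarrow> p \<in> poly_fam n E"
  by (auto simp: poly_fam_def)

lemma poly_fam_0: "p \<in> poly_fam n 0 \<Longrightarrow> p a = 0"
  by (auto simp: poly_fam_def poly_eq_iff)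

lemma poly_fam_drop_lead:
  assumes "p \<in> poly_fam n (Suc D)" "\<And>a. coeff (p a) D = 0"
  shows "p \<in> poly_fam n D"
  using assms by (auto simp: poly_fam_def dest: le_imp_less_or_eq simp flip: Suc_le_eq)

lemma poly_fam_monom:
  assumes "f \<in> poly_fun n"
  shows "(\<lambda>a. monom (f a) k) \<in> poly_fam n (Suc k)"
proof -
  have "(\<lambda>a. coeff (monom (f a) k) i) \<in> poly_fun n" for i
    by (cases "k = i") (auto intro: assms poly_fun.const)
  then show ?thesis by (simp add: poly_fam_def)
qed

lemma poly_fam_add:
  assumes "p \<in> poly_fam n D" "q \<in> poly_fam n E"
  shows "(\<lambda>a. p a + q a) \<in> poly_fam n (max D E)"
  using assms by (auto simp: poly_fam_def intro: poly_fun.add)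

lemma poly_fam_diff:
  assumes "p \<in> poly_fam n D" "q \<in> poly_fam n D"
  shows "(\<lambda>a. p a - q a) \<in> poly_fam n D"
  using assms by (auto simp: poly_fam_def intro: poly_fun_diff)

lemma poly_fam_smult:
  assumes "f \<in> poly_fun n" "p \<in> poly_fam n D"
  shows "(\<lambda>a. smult (f a) (p a)) \<in> poly_fam n D"
  using assms by (auto simp: poly_fam_def intro: poly_fun.mult)

lemma poly_fam_mult:
  assumes "p \<in> poly_fam n D" "q \<in> poly_fam n E"
  shows "(\<lambda>a. p a * q a) \<in> poly_fam n (D + E)"
proof -
  have "(\<lambda>a. coeff (p a * q a) i) \<in> poly_fun n" for i
    unfolding coeff_mult
    by (intro poly_fun_sum poly_fun.mult poly_fam_coeff[OF assms(1)] poly_fam_coeff[OF assms(2)])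
  moreover have "coeff (p a * q a) i = 0" if "D + E \<le> i" for a i
    unfolding coeff_mult
  proof (rule sum.neutral, rule ballI)
    fix k
    assume "k \<in> {..i}"
    then have "D \<le> k \<or> E \<le> i - k" using that by auto
    then show "coeff (p a) k * coeff (q a) (i - k) = 0"
      using poly_fam_coeff_eq_0[OF assms(1)] poly_fam_coeff_eq_0[OF assms(2)] by auto
  qed
  ultimately show ?thesis by (simp add: poly_fam_def)
qed

lemma poly_fam_power:
  assumes "p \<in> poly_fam n D"
  shows "\<exists>E. (\<lambda>a. p a ^ k) \<in> poly_fam n E"
proof (induction k)
  case 0
  have "(\<lambda>a. monom 1 0) \<in> poly_fam n (Suc 0)"
    by (rule poly_fam_monom) (rule poly_fun.const)
  then show ?case by (auto simp: monom_0 one_pCons)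
next
  case (Suc k)
  then show ?case by (auto intro: poly_fam_mult[OF assms])
qed

text \<open>The base point is fixed and the direction \<open>z\<close> varies, so the Taylor
  coefficients of \<open>f\<close> at \<open>y\<close> become polynomial functions of the direction.
  This drives both the product argument below and the expansion around a point later on.\<close>

lemma poly_fun_line:
  assumes "f \<in> poly_fun n"
  shows "\<exists>D. \<exists>p\<in>poly_fam n D. \<forall>z s. f (\<lambda>i. y i + s * z i) = poly (p z) s"
  using assms
proof (induction)
  case (const c)
  have "(\<lambda>a. monom c 0) \<in> poly_fam n (Suc 0)"
    by (rule poly_fam_monom) (rule poly_fun.const)
  then show ?case by (force simp: poly_monom)
next
  case (coord i)
  have "(\<lambda>z. monom (y i) 0 + monom (z i) 1) \<in> poly_fam n (max (Suc 0) (Suc 1))"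
    by (intro poly_fam_add poly_fam_monom poly_fun.const poly_fun.coord coord)
  then show ?case by (force simp: poly_monom)
next
  case (add f g)
  then show ?case by (metis poly_fam_add poly_add)
next
  case (mult f g)
  then show ?case by (metis poly_fam_mult poly_mult)
qed

lemma poly_fun_Suc_eq_poly:
  assumes "f \<in> poly_fun (Suc n)"
  shows "\<exists>D. \<exists>p\<in>poly_fam n D. \<forall>a T. f (a(n := T)) = poly (p a) T"
  using assms
proof (induction)
  case (const c)
  have "(\<lambda>a. monom c 0) \<in> poly_fam n (Suc 0)"
    by (rule poly_fam_monom) (rule poly_fun.const)
  then show ?case by (force simp: poly_monom)
next
  case (coord i)
  show ?case
  proof (cases "i = n")
    case True
    have "(\<lambda>a. monom 1 1) \<in> poly_fam n (Suc 1)"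
      by (rule poly_fam_monom) (rule poly_fun.const)
    with True show ?thesis by (force simp: poly_monom)
  next
    case False
    then have "(\<lambda>a. monom (a i) 0) \<in> poly_fam n (Suc 0)"
      using coord by (intro poly_fam_monom poly_fun.coord) auto
    with False show ?thesis by (force simp: poly_monom)
  qed
next
  case (add f g)
  then show ?case by (metis poly_fam_add poly_add)
next
  case (mult f g)
  then show ?case by (metis poly_fam_mult poly_mult)
qed

text \<open>Polynomial functions over an infinite field form an integral domain. On the line through
  \<open>a\<close> and \<open>b\<close> both factors restrict to nonzero univariate polynomials,
  whose product is nonzero and hence not identically zero as a function.\<close>

lemma poly_fun_mult_nonzero:
  assumes f: "f \<in> poly_fun n" and g: "g \<in> poly_fun n" and "f a \<noteq> 0" "g b \<noteq> 0"
  shows "\<exists>c. f c * g c \<noteq> 0"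
proof -
  obtain D p where p: "f (\<lambda>i. a i + s * z i) = poly (p z) s" for s z
    using poly_fun_line[OF f, of a] by blast
  obtain E q where q: "g (\<lambda>i. a i + s * z i) = poly (q z) s" for s z
    using poly_fun_line[OF g, of a] by blast
  define z where "z = (\<lambda>i. b i - a i)"
  have "poly (p z) 0 \<noteq> 0" "poly (q z) 1 \<noteq> 0"
    using assms by (simp_all add: z_def flip: p q)
  then have "p z * q z \<noteq> 0" by auto
  then obtain s where "poly (p z * q z) s \<noteq> 0"
    using poly_all_0_iff_0 by blast
  then show ?thesis by (auto simp flip: p q)
qed

section \<open>Constructible sets and elimination of a variable\<close>

text \<open>The Boolean algebra generated by the Zariski closed hypersurfaces of affine
  \<open>n\<close>-space. Points remain functions on all naturals, but membership depends on the
  first \<open>n\<close> coordinates only.\<close>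

inductive_set constructible :: "nat \<Rightarrow> (nat \<Rightarrow> complex) set set" for n :: nat where
  zero_set: "f \<in> poly_fun n \<Longrightarrow> {a. f a = 0} \<in> constructible n"
| compl: "S \<in> constructible n \<Longrightarrow> - S \<in> constructible n"
| inter: "S \<in> constructible n \<Longrightarrow> T \<in> constructible n \<Longrightarrow> S \<inter> T \<in> constructible n"

lemma constructible_nonzero_set:
  assumes "f \<in> poly_fun n"
  shows "{a. f a \<noteq> 0} \<in> constructible n"
  using constructible.compl[OF constructible.zero_set[OF assms]] by (simp add: Compl_eq)

lemma constructible_union:
  assumes "S \<in> constructible n" "T \<in> constructible n"
  shows "S \<union> T \<in> constructible n"
  using constructible.compl[OF constructible.inter[OF assms[THEN constructible.compl]]] by simp

lemma constructible_cong:
  assumes "S \<in> constructible n" "\<And>i. i < n \<Longrightarrow> a i = b i"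
  shows "a \<in> S \<longleftrightarrow> b \<in> S"
  using assms
proof (induction)
  case (zero_set f)
  then show ?case using poly_fun_cong[of f n a b] by simp
qed auto

lemma constructible_UNIV: "UNIV \<in> constructible n"
  using constructible.zero_set[OF poly_fun.const[of 0]] by simp

lemma constructible_Inter:
  assumes "finite F" "\<And>x. x \<in> F \<Longrightarrow> S x \<in> constructible n"
  shows "(\<Inter>x\<in>F. S x) \<in> constructible n"
  using assms by (induction) (auto intro: constructible.inter constructible_UNIV)

lemma constructible_Union:
  assumes "finite F" "\<And>x. x \<in> F \<Longrightarrow> S x \<in> constructible n"
  shows "(\<Union>x\<in>F. S x) \<in> constructible n"
  using constructible.compl[OF constructible_Inter[of F "\<lambda>x. - S x", OF assms(1)]] assms(2)
  by (simp add: constructible.compl)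

text \<open>The form in which elimination branches: \<open>f\<close> will be a formal leading
  coefficient, and \<open>A\<close> and \<open>B\<close> describe \<open>S\<close> where it vanishes
  and where it does not.\<close>

lemma constructible_split:
  assumes "f \<in> poly_fun n" "A \<in> constructible n" "B \<in> constructible n"
    and "\<And>a. f a = 0 \<Longrightarrow> a \<in> S \<longleftrightarrow> a \<in> A" "\<And>a. f a \<noteq> 0 \<Longrightarrow> a \<in> S \<longleftrightarrow> a \<in> B"
  shows "S \<in> constructible n"
proof -
  have "S = ({a. f a = 0} \<inter> A) \<union> ({a. f a \<noteq> 0} \<inter> B)"
    using assms(4,5) by auto
  then show ?thesis
    using assms(1-3) by (auto intro!: constructible_union constructible.inter
        constructible_nonzero_set constructible.zero_set)
qed

lemma constructible_poly_fam_nonzero: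
  assumes "p \<in> poly_fam n D"
  shows "{a. p a \<noteq> 0} \<in> constructible n"
proof -
  have "p a \<noteq> 0 \<longleftrightarrow> (\<exists>i<D. coeff (p a) i \<noteq> 0)" for a
    using poly_fam_coeff_eq_0[OF assms] by (metis leading_coeff_0_iff linorder_not_le coeff_0)
  then have "{a. p a \<noteq> 0} = (\<Union>i\<in>{..<D}. {a. coeff (p a) i \<noteq> 0})"
    by auto
  then show ?thesis
    using assms by (auto intro!: constructible_Union constructible_nonzero_set poly_fam_coeff)
qed

section \<open>Pseudo-division and elimination of one variable from a system\<close>

text \<open>One step of division with remainder, cross-multiplied by the formal leading coefficients
  instead of divided, so that all coefficients stay polynomial in the parameters.\<close>

lemma poly_fam_cancel_lead:
  assumes p: "p \<in> poly_fam n (Suc D)" and q: "q \<in> poly_fam n (Suc E)" and "D \<le> E"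
  shows "(\<lambda>a. smult (coeff (p a) D) (q a) - monom (coeff (q a) E) (E - D) * p a) \<in> poly_fam n E"
proof -
  have "(\<lambda>a. monom (coeff (q a) E) (E - D) * p a) \<in> poly_fam n (Suc (E - D) + Suc D)"
    by (intro poly_fam_mult poly_fam_monom poly_fam_coeff[OF q] p)
  \<comment> \<open>Adding strict degree bounds gives \<open>E + 2\<close>, one more than the true
    bound, so the coefficient at \<open>Suc E\<close> has to be checked by hand.\<close>
  moreover have "coeff (monom (coeff (q a) E) (E - D) * p a) (Suc E) = 0" for a
    using \<open>D \<le> E\<close> poly_fam_coeff_eq_0[OF p] by (simp add: coeff_monom_mult)
  ultimately have "(\<lambda>a. monom (coeff (q a) E) (E - D) * p a) \<in> poly_fam n (Suc E)"
    by (intro poly_fam_drop_lead[of _ n "Suc E"]) (use \<open>D \<le> E\<close> in auto)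
  then have "(\<lambda>a. smult (coeff (p a) D) (q a) - monom (coeff (q a) E) (E - D) * p a) \<in> poly_fam n (Suc E)"
    by (rule poly_fam_diff[OF poly_fam_smult[OF poly_fam_coeff[OF p, of D] q]])
  then show ?thesis
    by (rule poly_fam_drop_lead) (use \<open>D \<le> E\<close> in \<open>simp add: coeff_monom_mult\<close>)
qed

text \<open>Repeated cancellation of leading terms lowers the bound of \<open>q\<close> until it is
  at most \<open>D\<close>; each step contributes one factor of the leading coefficient of
  \<open>p\<close>.\<close>

lemma poly_fam_pseudo_remainder:
  assumes p: "p \<in> poly_fam n (Suc D)" and q: "q \<in> poly_fam n E"
  shows "\<exists>r\<in>poly_fam n D. \<exists>k u. \<forall>a. smult (coeff (p a) D ^ k) (q a) = u a * p a + r a"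
  using q
proof (induction E arbitrary: q)
  case 0
  then have "smult (coeff (p a) D ^ 0) (q a) = 0 * p a + q a" "q \<in> poly_fam n D" for a
    by (auto intro: poly_fam_mono)
  then show ?case by (intro bexI[of _ q] exI[of _ 0] exI[of _ "\<lambda>a. 0"]) auto
next
  case (Suc E)
  show ?case
  proof (cases "D \<le> E")
    case False
    then have "q \<in> poly_fam n D" by (intro poly_fam_mono[OF Suc.prems]) auto
    then show ?thesis by (intro bexI[of _ q] exI[of _ 0] exI[of _ "\<lambda>a. 0"]) auto
  next
    case True
    from Suc.IH[OF poly_fam_cancel_lead[OF p Suc.prems True]] obtain r k u
      where r: "r \<in> poly_fam n D"
      and eq: "\<And>a. smult (coeff (p a) D ^ k) (smult (coeff (p a) D) (q a)
                      - monom (coeff (q a) E) (E - D) * p a) = u a * p a + r a"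
      by blast
    have "smult (coeff (p a) D ^ Suc k) (q a)
        = (u a + smult (coeff (p a) D ^ k) (monom (coeff (q a) E) (E - D))) * p a + r a" for a
      using eq[of a] by (simp add: algebra_simps smult_diff_right)
    then show ?thesis by (intro bexI[OF _ r] exI allI)
  qed
qed

lemma poly_fam_truncate:
  assumes "p \<in> poly_fam n (Suc D)"
  shows "(\<lambda>a. p a - monom (coeff (p a) D) D) \<in> poly_fam n D"
  by (rule poly_fam_drop_lead[OF poly_fam_diff[OF assms poly_fam_monom[OF poly_fam_coeff[OF assms]]]]) simp

lemma constructible_ex_nonroot:
  assumes "q \<in> poly_fam n E"
  shows "{a. \<exists>T. poly (q a) T \<noteq> 0} \<in> constructible n"
proof -
  have "(\<exists>T. poly (q a) T \<noteq> 0) \<longleftrightarrow> q a \<noteq> 0" for a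
    using poly_all_0_iff_0[of "q a"] by auto
  then show ?thesis using constructible_poly_fam_nonzero[OF assms] by simp
qed

text \<open>If \<open>p a\<close> has exact degree \<open>D\<close>, all its roots are roots of
  \<open>q a\<close> iff \<open>p a\<close> divides \<open>q a ^ D\<close>, since multiplicities are
  at most \<open>D\<close>. Divisibility means that the pseudo-remainder vanishes, a condition on
  its coefficients. Where the leading coefficient vanishes, truncation lowers the bound.\<close>

lemma constructible_ex_root:
  assumes "p \<in> poly_fam n D" "q \<in> poly_fam n E"
  shows "{a. \<exists>T. poly (p a) T = 0 \<and> poly (q a) T \<noteq> 0} \<in> constructible n"
  using assms(1)
proof (induction D arbitrary: p)
  case 0
  then show ?case using constructible_ex_nonroot[OF assms(2)] by (simp add: poly_fam_0)
next
  case (Suc D)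
  obtain E' where "(\<lambda>a. q a ^ D) \<in> poly_fam n E'"
    using poly_fam_power[OF assms(2)] by blast
  from poly_fam_pseudo_remainder[OF Suc.prems this] obtain r k u
    where r: "r \<in> poly_fam n D"
      and eq: "\<And>a. smult (coeff (p a) D ^ k) (q a ^ D) = u a * p a + r a"
    by blast
  show ?case
  proof (rule constructible_split[OF poly_fam_coeff[OF Suc.prems, of D]
          Suc.IH[OF poly_fam_truncate[OF Suc.prems]] constructible_poly_fam_nonzero[OF r]])
    fix a
    assume lc: "coeff (p a) D \<noteq> 0"
    then have deg: "degree (p a) = D"
      using poly_fam_coeff_eq_0[OF Suc.prems]
      by (metis Suc_leI degree_le le_antisym le_degree)
    have "p a dvd q a ^ D \<longleftrightarrow> p a dvd r a"
      using eq[of a] lc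
      by (metis dvd_add_right_iff dvd_smult_iff dvd_triv_right power_eq_0_iff)
    also have "\<dots> \<longleftrightarrow> r a = 0"
    proof
      assume dvd: "p a dvd r a"
      show "r a = 0"
      proof (rule ccontr)
        assume "r a \<noteq> 0"
        then have "D \<le> degree (r a)" using dvd_imp_degree_le[OF dvd] deg by simp
        then show False using poly_fam_coeff_eq_0[OF r] \<open>r a \<noteq> 0\<close> leading_coeff_0_iff by blast
      qed
    qed simp
    finally show "a \<in> {a. \<exists>T. poly (p a) T = 0 \<and> poly (q a) T \<noteq> 0} \<longleftrightarrow> a \<in> {a. r a \<noteq> 0}"
      using nullstellensatz_univariate[of "p a" "q a"] lc deg by auto
  qed simp
qed

text \<open>Euclid's algorithm with parameters: each step lowers the bound of one of two equations
  or discards a zero equation, until at most one equation is left. The summand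
  \<open>length ps\<close> in the measure accounts for discarding.\<close>

lemma constructible_ex_common_root:
  assumes "\<And>D p. (D, p) \<in> set ps \<Longrightarrow> p \<in> poly_fam n D" and q: "q \<in> poly_fam n E"
  shows "{a. \<exists>T. (\<forall>(D, p)\<in>set ps. poly (p a) T = 0) \<and> poly (q a) T \<noteq> 0} \<in> constructible n"
  using assms(1)
proof (induction "sum_list (map fst ps) + length ps" arbitrary: ps rule: less_induct)
  case less
  have step: "{a. \<exists>T. (\<forall>(D, p)\<in>set ((D, p) # (E, p') # zs). poly (p a) T = 0) \<and> poly (q a) T \<noteq> 0}
                \<in> constructible n"
    if m: "sum_list (map fst ps) + length ps = D + E + sum_list (map fst zs) + length zs + 2"
      and p: "p \<in> poly_fam n D" and p': "p' \<in> poly_fam n E"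
      and zs: "\<And>D p. (D, p) \<in> set zs \<Longrightarrow> p \<in> poly_fam n D"
      and le: "D \<le> E" for D p E p' zs
  proof (cases D)
    case 0
    then have "p a = 0" for a using p poly_fam_0 by blast
    moreover have "{a. \<exists>T. (\<forall>(D, p)\<in>set ((E, p') # zs). poly (p a) T = 0) \<and> poly (q a) T \<noteq> 0}
                \<in> constructible n"
      by (rule less.hyps) (use m p' zs in auto)
    ultimately show ?thesis by simp
  next
    case (Suc D')
    then obtain E' where E': "E = Suc E'" using le by (cases E) auto
    note p = p[unfolded Suc] and p' = p'[unfolded E']
    define p1 where "p1 = (\<lambda>a. p a - monom (coeff (p a) D') D')"
    define p2 where "p2 = (\<lambda>a. smult (coeff (p a) D') (p' a) - monom (coeff (p' a) E') (E' - D') * p a)"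
    have p1: "p1 \<in> poly_fam n D'"
      unfolding p1_def using poly_fam_truncate[OF p] .
    have p2: "p2 \<in> poly_fam n E'"
      unfolding p2_def using poly_fam_cancel_lead[OF p p'] le Suc E' by simp
    have c1: "{a. \<exists>T. (\<forall>(D, p)\<in>set ((D', p1) # (E, p') # zs). poly (p a) T = 0) \<and> poly (q a) T \<noteq> 0}
                \<in> constructible n"
      by (rule less.hyps) (use m p1 p' zs Suc E' in auto)
    have c2: "{a. \<exists>T. (\<forall>(D, p)\<in>set ((D, p) # (E', p2) # zs). poly (p a) T = 0) \<and> poly (q a) T \<noteq> 0}
                \<in> constructible n"
      by (rule less.hyps) (use m p p2 zs Suc E' in auto)
    \<comment> \<open>Where the leading coefficient of \<open>p\<close> vanishes, \<open>p\<close>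
      equals its truncation \<open>p1\<close>. Elsewhere, at a root of \<open>p\<close>, the
      polynomial \<open>p2\<close> is a nonzero multiple of \<open>p'\<close>, so replacing
      \<open>p'\<close> by \<open>p2\<close> keeps the common roots.\<close>
    show ?thesis
      by (rule constructible_split[OF poly_fam_coeff[OF p, of D'] c1 c2])
         (auto simp: p1_def p2_def cong: conj_cong)
  qed
  consider "ps = []" | D p where "ps = [(D, p)]"
    | D p E p' zs where "ps = (D, p) # (E, p') # zs"
    by (metis list.exhaust surj_pair)
  then show ?case
  proof cases
    case 1
    then show ?thesis using constructible_ex_nonroot[OF q] by simp
  next
    case 2
    then show ?thesis using constructible_ex_root[OF _ q] less.prems by simp
  next
    case 3
    have prems: "p \<in> poly_fam n D" "p' \<in> poly_fam n E" "\<And>D p. (D, p) \<in> set zs \<Longrightarrow> p \<in> poly_fam n D"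
      using less.prems 3 by auto
    show ?thesis
    proof (cases "D \<le> E")
      case True
      show ?thesis unfolding 3 by (rule step) (use prems True 3 in auto)
    next
      case False
      have *: "set ((D, p) # (E, p') # zs) = set ((E, p') # (D, p) # zs)" by auto
      show ?thesis unfolding 3 * by (rule step) (use prems False 3 in auto)
    qed
  qed
qed

section \<open>Disjunctive normal form and projections of constructible sets\<close>

text \<open>A single inequation is enough, because finitely many can be multiplied into one; this
  matches the shape handled by the elimination above.\<close>

definition basic_sets :: "nat \<Rightarrow> (nat \<Rightarrow> complex) set set" where
  "basic_sets n = {{a. (\<forall>f\<in>set fs. f a = 0) \<and> g a \<noteq> 0} | fs g. set fs \<subseteq> poly_fun n \<and> g \<in> poly_fun n}"

lemma basic_sets_inter:
  assumes "A \<in> basic_sets n" "B \<in> basic_sets n"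
  shows "A \<inter> B \<in> basic_sets n"
proof -
  obtain fs g where A: "A = {a. (\<forall>f\<in>set fs. f a = 0) \<and> g a \<noteq> 0}" "set fs \<subseteq> poly_fun n" "g \<in> poly_fun n"
    using assms(1) by (auto simp: basic_sets_def)
  obtain fs' g' where B: "B = {a. (\<forall>f\<in>set fs'. f a = 0) \<and> g' a \<noteq> 0}" "set fs' \<subseteq> poly_fun n" "g' \<in> poly_fun n"
    using assms(2) by (auto simp: basic_sets_def)
  have "A \<inter> B = {a. (\<forall>f\<in>set (fs @ fs'). f a = 0) \<and> g a * g' a \<noteq> 0}"
    by (auto simp: A B)
  moreover have "set (fs @ fs') \<subseteq> poly_fun n" "(\<lambda>a. g a * g' a) \<in> poly_fun n"
    using A B by (auto intro: poly_fun.mult)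
  ultimately show ?thesis
    unfolding basic_sets_def
    by (intro CollectI exI[of _ "fs @ fs'"] exI[of _ "\<lambda>a. g a * g' a"]) auto
qed

text \<open>Proving the claim for \<open>S\<close> and \<open>- S\<close> together makes the
  complement case a mere swap; intersections distribute over the unions, and De Morgan handles their
  complements.\<close>

lemma constructible_disjunctive_normal_form:
  assumes "S \<in> constructible n"
  shows "(\<exists>\<B>. finite \<B> \<and> \<B> \<subseteq> basic_sets n \<and> S = \<Union>\<B>) \<and>
         (\<exists>\<B>. finite \<B> \<and> \<B> \<subseteq> basic_sets n \<and> - S = \<Union>\<B>)"
  using assms
proof (induction)
  case (zero_set f)
  have "{a. f a = 0} \<in> basic_sets n"
    unfolding basic_sets_def
    by (intro CollectI exI[of _ "[f]"] exI[of _ "\<lambda>a. 1"]) (simp add: zero_set poly_fun.const)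
  moreover have "- {a. f a = 0} \<in> basic_sets n"
    unfolding basic_sets_def
    by (intro CollectI exI[of _ "[]"] exI[of _ f]) (auto simp: zero_set)
  ultimately show ?case
    by (intro conjI exI[of _ "{{a. f a = 0}}"] exI[of _ "{- {a. f a = 0}}"]) auto
next
  case (compl S)
  then show ?case by simp
next
  case (inter S T)
  then obtain \<A> \<B> \<C> \<D> where
    *: "finite \<A>" "\<A> \<subseteq> basic_sets n" "S = \<Union>\<A>" "finite \<B>" "\<B> \<subseteq> basic_sets n" "T = \<Union>\<B>"
       "finite \<C>" "\<C> \<subseteq> basic_sets n" "- S = \<Union>\<C>" "finite \<D>" "\<D> \<subseteq> basic_sets n" "- T = \<Union>\<D>"
    by auto
  have "S \<inter> T = \<Union>((\<lambda>(A, B). A \<inter> B) ` (\<A> \<times> \<B>))" "finite ((\<lambda>(A, B). A \<inter> B) ` (\<A> \<times> \<B>))"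
    "(\<lambda>(A, B). A \<inter> B) ` (\<A> \<times> \<B>) \<subseteq> basic_sets n"
    using * by (auto intro!: basic_sets_inter)
  moreover have "- (S \<inter> T) = \<Union>(\<C> \<union> \<D>)" "finite (\<C> \<union> \<D>)" "\<C> \<union> \<D> \<subseteq> basic_sets n"
    using * by auto
  ultimately show ?case by (intro conjI) (rule exI, intro conjI; assumption)+
qed

lemma constructible_project_basic:
  assumes "S \<in> basic_sets (Suc n)"
  shows "{a. \<exists>T. a(n := T) \<in> S} \<in> constructible n"
proof -
  obtain fs g where S: "S = {a. (\<forall>f\<in>set fs. f a = 0) \<and> g a \<noteq> 0}"
    and fs: "\<And>f. f \<in> set fs \<Longrightarrow> f \<in> poly_fun (Suc n)" and g: "g \<in> poly_fun (Suc n)"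
    using assms by (auto simp: basic_sets_def)
  obtain E q where q: "q \<in> poly_fam n E" "\<And>a T. g (a(n := T)) = poly (q a) T"
    using poly_fun_Suc_eq_poly[OF g] by blast
  have "\<forall>f\<in>set fs. \<exists>x. snd x \<in> poly_fam n (fst x) \<and> (\<forall>a T. f (a(n := T)) = poly (snd x a) T)"
    using poly_fun_Suc_eq_poly[OF fs] by (metis fst_conv snd_conv)
  then obtain \<phi> where \<phi>: "\<And>f. f \<in> set fs \<Longrightarrow> snd (\<phi> f) \<in> poly_fam n (fst (\<phi> f))"
    "\<And>f a T. f \<in> set fs \<Longrightarrow> f (a(n := T)) = poly (snd (\<phi> f) a) T"
    by metis
  have "{a. \<exists>T. a(n := T) \<in> S}
      = {a. \<exists>T. (\<forall>(D, p)\<in>set (map \<phi> fs). poly (p a) T = 0) \<and> poly (q a) T \<noteq> 0}"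
    by (auto simp: S \<phi>(2) q(2) split_beta)
  also have "\<dots> \<in> constructible n"
  proof (rule constructible_ex_common_root[OF _ q(1)])
    fix D p
    assume "(D, p) \<in> set (map \<phi> fs)"
    then obtain f where "f \<in> set fs" "(D, p) = \<phi> f" by auto
    then show "p \<in> poly_fam n D" using \<phi>(1)[of f] by (metis fst_conv snd_conv)
  qed
  finally show ?thesis .
qed

text \<open>The existential quantifier commutes with the finite union of the normal form, which
  leaves basic sets only.\<close>

lemma constructible_project:
  assumes "S \<in> constructible (Suc n)"
  shows "{a. \<exists>T. a(n := T) \<in> S} \<in> constructible n"
proof -
  obtain \<B> where \<B>: "finite \<B>" "\<B> \<subseteq> basic_sets (Suc n)" "S = \<Union>\<B>"
    using constructible_disjunctive_normal_form[OF assms] by blast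
  have "{a. \<exists>T. a(n := T) \<in> S} = (\<Union>B\<in>\<B>. {a. \<exists>T. a(n := T) \<in> B})"
    using \<B>(3) by blast
  then show ?thesis
    using \<B>(1,2) by (auto intro!: constructible_Union constructible_project_basic)
qed

lemma constructible_project_many:
  assumes "S \<in> constructible (n + M)"
  shows "{a. \<exists>b. (\<lambda>i. if i < n then a i else b i) \<in> S} \<in> constructible n"
  using assms
proof (induction M arbitrary: S)
  case 0
  have "(\<lambda>i. if i < n then a i else b i) \<in> S \<longleftrightarrow> a \<in> S" for a b
    by (rule constructible_cong[of S n]) (use 0 in auto)
  then show ?case using 0 by simp
next
  case (Suc M)
  \<comment> \<open>The last coordinate \<open>T\<close>, eliminated first, can be absorbed into
    \<open>b\<close>.\<close>
  have "(\<exists>b T. (\<lambda>i. if i < n then a i else b i)(n + M := T) \<in> S) \<longleftrightarrow>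
    (\<exists>b. (\<lambda>i. if i < n then a i else b i) \<in> S)" for a
  proof
    assume "\<exists>b T. (\<lambda>i. if i < n then a i else b i)(n + M := T) \<in> S"
    then obtain b T where "(\<lambda>i. if i < n then a i else b i)(n + M := T) \<in> S" by blast
    moreover have "(\<lambda>i. if i < n then a i else b i)(n + M := T)
        = (\<lambda>i. if i < n then a i else (b(n + M := T)) i)" by auto
    ultimately show "\<exists>b. (\<lambda>i. if i < n then a i else b i) \<in> S" by metis
  qed (metis fun_upd_triv)
  then show ?case
    using Suc.IH[OF constructible_project[of S "n + M"]] Suc.prems by simp
qed

section \<open>Generic sets and the dichotomy for constructible sets\<close>

definition generic :: "nat \<Rightarrow> (nat \<Rightarrow> complex) set \<Rightarrow> bool" where
  "generic n S \<longleftrightarrow> (\<exists>g\<in>poly_fun n. (\<exists>a. g a \<noteq> 0) \<and> (\<forall>a. g a \<noteq> 0 \<longrightarrow> a \<in> S))"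

lemma genericI: "g \<in> poly_fun n \<Longrightarrow> g b \<noteq> 0 \<Longrightarrow> (\<And>a. g a \<noteq> 0 \<Longrightarrow> a \<in> S) \<Longrightarrow> generic n S"
  unfolding generic_def by blast

lemma generic_mono: "generic n S \<Longrightarrow> S \<subseteq> T \<Longrightarrow> generic n T"
  unfolding generic_def by (meson subsetD)

text \<open>Irreducibility of affine space: two nonempty principal open sets meet in the principal
  open set of the product, which is again nonempty.\<close>

lemma generic_inter:
  assumes "generic n S" "generic n T"
  shows "generic n (S \<inter> T)"
proof -
  obtain f a where f: "f \<in> poly_fun n" "f a \<noteq> 0" "\<And>a. f a \<noteq> 0 \<Longrightarrow> a \<in> S"
    using assms(1) unfolding generic_def by blast
  obtain g b where g: "g \<in> poly_fun n" "g b \<noteq> 0" "\<And>a. g a \<noteq> 0 \<Longrightarrow> a \<in> T"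
    using assms(2) unfolding generic_def by blast
  obtain c where "f c * g c \<noteq> 0"
    using poly_fun_mult_nonzero[OF f(1) g(1) f(2) g(2)] by blast
  then show ?thesis
    by (rule genericI[OF poly_fun.mult[OF f(1) g(1)]]) (simp add: f g)
qed

text \<open>Induction over the Boolean operations. For an intersection, either both sets are generic
  and irreducibility applies, or one complement is generic and lies in the complement of the
  intersection.\<close>

lemma constructible_generic_or_compl:
  assumes "S \<in> constructible n"
  shows "generic n S \<or> generic n (- S)"
  using assms
proof (induction)
  case (zero_set f)
  show ?case
  proof (cases "\<exists>a. f a \<noteq> 0")
    case True
    then obtain b where "f b \<noteq> 0" by blast
    with zero_set have "generic n (- {a. f a = 0})" by (rule genericI) simp
    then show ?thesis ..
  next
    case False
    have "generic n {a. f a = 0}"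
      by (rule genericI[OF poly_fun.const[of 1]]) (use False in auto)
    then show ?thesis ..
  qed
next
  case (compl S)
  then show ?case by auto
next
  case (inter S T)
  have "generic n (- (S \<inter> T))" if "generic n (- S) \<or> generic n (- T)"
    using that by (metis Compl_Int generic_mono sup_ge1 sup_ge2)
  with inter.IH generic_inter show ?case by blast
qed

section \<open>Images of polynomial maps with surjective differential\<close>

text \<open>Expand \<open>h\<close> around \<open>y0\<close>: its lowest-order homogeneous part vanishes at every velocity
  of a curve through \<open>y0\<close> inside the zero set.\<close>

lemma poly_fun_eq_0_if_all_velocities:
  assumes h: "h \<in> poly_fun n"
    and curve: "\<And>z. \<exists>y. y 0 = y0 \<and> (\<forall>s. h (y s) = 0) \<and>
                 (\<forall>i<n. ((\<lambda>s. y s i) has_field_derivative z i) (at 0))"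
  shows "h a = 0"
proof (rule ccontr)
  assume "h a \<noteq> 0"
  obtain D p where p: "p \<in> poly_fam n D" and hp: "\<And>z s. h (\<lambda>i. y0 i + s * z i) = poly (p z) s"
    using poly_fun_line[OF h, of y0] by blast
  have "poly (p (\<lambda>i. a i - y0 i)) 1 \<noteq> 0"
    using \<open>h a \<noteq> 0\<close> by (simp flip: hp)
  then have "p (\<lambda>i. a i - y0 i) \<noteq> 0" by auto
  then have ex: "\<exists>k z. coeff (p z) k \<noteq> 0"
    by (auto simp: poly_eq_iff)
  \<comment> \<open>The order of vanishing of \<open>h\<close> at \<open>y0\<close>;
    \<open>coeff (p z) k\<close> is the lowest homogeneous part, evaluated at
    \<open>z\<close>.\<close>
  define k where "k = (LEAST k. \<exists>z. coeff (p z) k \<noteq> 0)"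
  obtain z where z: "coeff (p z) k \<noteq> 0"
    using LeastI_ex[OF ex] unfolding k_def by blast
  have below_k: "coeff (p z) i = 0" if "i < k" for i z
    using not_less_Least[of i "\<lambda>k. \<exists>z. coeff (p z) k \<noteq> 0"] that unfolding k_def by blast
  \<comment> \<open>The summation range does not depend on \<open>z\<close>, so that below the
    direction may move with \<open>s\<close> and the limit can be taken termwise.\<close>
  have expand: "poly (p z) s = s ^ k * (\<Sum>i<D. coeff (p z) (i + k) * s ^ i)" for z s
  proof -
    have "poly (p z) s = (\<Sum>i<k+D. coeff (p z) i * s ^ i)"
    proof (cases "p z = 0")
      case False
      then have "degree (p z) < k + D"
        using poly_fam_coeff_eq_0[OF p] by (metis leading_coeff_0_iff le_add2 le_trans not_le)
      then show ?thesis
        unfolding poly_altdef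
        by (intro sum.mono_neutral_left) (auto simp: coeff_eq_0 not_le)
    qed simp
    also have "\<dots> = (\<Sum>i\<in>{k..<k+D}. coeff (p z) i * s ^ i)"
      by (rule sum.mono_neutral_right) (auto simp: below_k)
    also have "\<dots> = (\<Sum>i\<in>{0+k..<D+k}. coeff (p z) i * s ^ i)"
      by (simp add: add.commute)
    also have "\<dots> = (\<Sum>i<D. coeff (p z) (i + k) * s ^ (i + k))"
      unfolding sum.shift_bounds_nat_ivl by (simp add: atLeast0LessThan)
    finally show ?thesis by (simp add: sum_distrib_left power_add mult_ac)
  qed
  obtain y where y: "y 0 = y0" "\<And>s. h (y s) = 0"
    "\<And>i. i < n \<Longrightarrow> ((\<lambda>s. y s i) has_field_derivative z i) (at 0)"
    using curve[of z] by blast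
  \<comment> \<open>Secant directions of the curve, tending to \<open>z\<close>. Since
    \<open>h\<close> vanishes along the curve, dividing the expansion in direction
    \<open>zs s\<close> by \<open>s ^ k\<close> and letting \<open>s\<close> tend to 0 gives
    \<open>coeff (p z) k = 0\<close>.\<close>
  define zs where "zs = (\<lambda>s i. (y s i - y0 i) / s)"
  have lim: "((\<lambda>s. zs s i) \<longlongrightarrow> z i) (at 0)" if "i < n" for i
    using y(3)[OF that] unfolding has_field_derivative_iff zs_def by (simp add: y(1))
  have lim1: "((\<lambda>s. \<Sum>i<D. coeff (p (zs s)) (i + k) * s ^ i)
      \<longlongrightarrow> (\<Sum>i<D. coeff (p z) (i + k) * 0 ^ i)) (at 0)"
    by (intro tendsto_intros poly_fun_tendsto[OF poly_fam_coeff[OF p]] lim)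
  have "D \<noteq> 0"
    using poly_fam_coeff_eq_0[OF p, of k z] z by (cases D) auto
  then have eq: "(\<Sum>i<D. coeff (p z) (i + k) * 0 ^ i) = coeff (p z) k"
    by (simp add: sum.remove[of _ 0] power_0_left)
  have "(\<Sum>i<D. coeff (p (zs s)) (i + k) * s ^ i) = 0" if "s \<noteq> 0" for s
  proof -
    have "y s = (\<lambda>i. y0 i + s * zs s i)"
      using that by (simp add: zs_def)
    then have "poly (p (zs s)) s = 0" using y(2)[of s] hp by metis
    then show ?thesis using that by (simp add: expand)
  qed
  then have lim2: "((\<lambda>s. \<Sum>i<D. coeff (p (zs s)) (i + k) * s ^ i) \<longlongrightarrow> 0) (at 0)"
    by (intro tendsto_eventually) (auto simp: eventually_at_filter)
  show False
    using LIM_unique[OF lim1 lim2] eq z by simp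
qed

section \<open>Derivatives of curves of polynomials\<close>

definition coeff_deriv :: "(complex \<Rightarrow> complex poly) \<Rightarrow> complex poly \<Rightarrow> bool" where
  "coeff_deriv P P' \<longleftrightarrow> (\<forall>i. ((\<lambda>s. coeff (P s) i) has_field_derivative coeff P' i) (at 0))"

lemma coeff_deriv_line: "coeff_deriv (\<lambda>s. p + smult s q) q"
  unfolding coeff_deriv_def by (auto intro!: derivative_eq_intros)

lemma coeff_deriv_add:
  "coeff_deriv P P' \<Longrightarrow> coeff_deriv Q Q' \<Longrightarrow> coeff_deriv (\<lambda>s. P s + Q s) (P' + Q')"
  unfolding coeff_deriv_def by (auto intro!: derivative_eq_intros)

lemma coeff_deriv_sum:
  "(\<And>j. j \<in> A \<Longrightarrow> coeff_deriv (P j) (P' j)) \<Longrightarrow> coeff_deriv (\<lambda>s. \<Sum>j\<in>A. P j s) (\<Sum>j\<in>A. P' j)"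
  unfolding coeff_deriv_def coeff_sum by (auto intro!: DERIV_sum)

lemma coeff_deriv_mult:
  assumes "coeff_deriv P P'" "coeff_deriv Q Q'"
  shows "coeff_deriv (\<lambda>s. P s * Q s) (P' * Q 0 + P 0 * Q')"
  unfolding coeff_deriv_def
proof
  fix i
  have "((\<lambda>s. \<Sum>k\<le>i. coeff (P s) k * coeff (Q s) (i - k)) has_field_derivative
      (\<Sum>k\<le>i. coeff P' k * coeff (Q 0) (i - k) + coeff Q' (i - k) * coeff (P 0) k)) (at 0)"
    using assms unfolding coeff_deriv_def by (intro DERIV_sum DERIV_mult) auto
  moreover have "coeff (P' * Q 0 + P 0 * Q') i
      = (\<Sum>k\<le>i. coeff P' k * coeff (Q 0) (i - k) + coeff Q' (i - k) * coeff (P 0) k)"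
    by (simp add: coeff_mult sum.distrib mult.commute[of "coeff Q' _"])
  ultimately show "((\<lambda>s. coeff (P s * Q s) i) has_field_derivative coeff (P' * Q 0 + P 0 * Q') i) (at 0)"
    by (simp add: coeff_mult)
qed

lemma coeff_deriv_power:
  assumes "coeff_deriv P P'"
  shows "coeff_deriv (\<lambda>s. P s ^ k) (of_nat k * P 0 ^ (k - 1) * P')"
proof (induction k)
  case 0
  then show ?case by (simp add: coeff_deriv_def)
next
  case (Suc k)
  show ?case
    using coeff_deriv_mult[OF assms Suc.IH] by (cases k) (simp_all add: algebra_simps)
qed

section \<open>Spanning by multiples of powers of linear forms\<close>

text \<open>Adjoin \<open>p\<close> to a basis of the subspace \<open>S\<close>, prescribe the value
  1 at \<open>p\<close> and 0 on the basis, and extend linearly.\<close>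

lemma separating_functional:
  assumes S: "0 \<in> S" "\<And>p q. p \<in> S \<Longrightarrow> q \<in> S \<Longrightarrow> p + q \<in> S" "\<And>c p. p \<in> S \<Longrightarrow> smult c p \<in> S"
    and p: "p \<notin> S"
  obtains \<phi> :: "complex poly \<Rightarrow> complex"
  where "\<And>p q. \<phi> (p + q) = \<phi> p + \<phi> q" "\<And>c p. \<phi> (smult c p) = c * \<phi> p"
    "\<And>q. q \<in> S \<Longrightarrow> \<phi> q = 0" "\<phi> p \<noteq> 0"
proof -
  interpret vector_space_pair "smult :: complex \<Rightarrow> complex poly \<Rightarrow> complex poly"
    "(*) :: complex \<Rightarrow> complex \<Rightarrow> complex"
    by unfold_locales (simp_all add: algebra_simps smult_add_left smult_add_right)
  have sub: "vs1.subspace S"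
    unfolding vs1.subspace_def using S by blast
  obtain B where B: "B \<subseteq> S" "vs1.independent B" "S \<subseteq> vs1.span B"
    using vs1.maximal_independent_subset[of S] by blast
  have span: "vs1.span B \<subseteq> S"
    using vs1.span_minimal[OF B(1) sub] .
  then have "vs1.independent (insert p B)"
    using B p by (intro vs1.independent_insertI) auto
  from linear_independent_extend[OF this, of "\<lambda>q. if q = p then 1 else 0"]
  obtain \<phi> where lin: "Vector_Spaces.linear smult (*) \<phi>"
    and \<phi>: "\<And>q. q \<in> insert p B \<Longrightarrow> \<phi> q = (if q = p then 1 else 0)" by blast
  interpret \<phi>: Vector_Spaces.linear "smult :: complex \<Rightarrow> complex poly \<Rightarrow> complex poly" "(*)" \<phi>
    by (fact lin)
  have "\<phi> q = 0" if "q \<in> S" for q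
  proof (rule \<phi>.eq_0_on_span[of B])
    show "\<phi> x = 0" if "x \<in> B" for x using \<phi>[of x] that B(1) p by auto
  qed (use that B(3) in auto)
  moreover have "\<phi> p \<noteq> 0" using \<phi>[of p] by simp
  ultimately show ?thesis using that[of \<phi>] \<phi>.add \<phi>.scale by blast
qed

lemma smult_sum_right: "smult x (\<Sum>i\<in>A. f i) = (\<Sum>i\<in>A. smult x (f i))"
  by (induction A rule: infinite_finite_induct) (simp_all add: smult_add_right)

text \<open>Binomial theorem for \<open>(X - c) - s\<close>. It is used around a root
  \<open>c\<close>, and with \<open>c = 0\<close> to read off the coefficients of
  \<open>H\<close>.\<close>

lemma linear_power_expand:
  fixes c s :: complex
  shows "[:- (c + s), 1:] ^ d = (\<Sum>j\<le>d. smult (of_nat (d choose j) * (- s) ^ j) ([:- c, 1:] ^ (d - j)))"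
proof -
  have "[:- (c + s), 1:] = [:- s:] + [:- c, 1:]" by simp
  then have "[:- (c + s), 1:] ^ d = (\<Sum>j\<le>d. of_nat (d choose j) * [:- s:] ^ j * [:- c, 1:] ^ (d - j))"
    by (simp only: binomial_ring)
  also have "\<dots> = (\<Sum>j\<le>d. smult (of_nat (d choose j) * (- s) ^ j) ([:- c, 1:] ^ (d - j)))"
    by (simp add: poly_const_pow of_nat_poly mult.commute)
  finally show ?thesis .
qed

text \<open>\<open>poly H c\<close> is the value of the functional at the \<open>d\<close>-th power of \<open>X - c\<close>; if the functional kills
  all multiples of a power of \<open>X - c\<close>, then Taylor expansion shows that \<open>H\<close> has a multiple root at \<open>c\<close>.\<close>

lemma apolar_root:
  fixes \<phi> :: "complex poly \<Rightarrow> complex" and H :: "complex poly"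
  assumes add: "\<And>p q. \<phi> (p + q) = \<phi> p + \<phi> q" and smult: "\<And>c p. \<phi> (smult c p) = c * \<phi> p"
    and H: "\<And>c. poly H c = \<phi> ([:- c, 1:] ^ d)"
    and e: "e \<le> d" and zero: "\<And>g. degree g \<le> e \<Longrightarrow> \<phi> ([:- c, 1:] ^ (d - e) * g) = 0"
  shows "[:- c, 1:] ^ Suc e dvd H"
proof -
  have sum: "\<phi> (\<Sum>j\<in>A. f j) = (\<Sum>j\<in>A. \<phi> (f j))" for A :: "nat set" and f
    using smult[of 0 0] by (induction A rule: infinite_finite_induct) (simp_all add: add)
  \<comment> \<open>These powers are multiples of \<open>[:- c, 1:] ^ (d - e)\<close> with cofactor
    of degree at most \<open>e\<close>, so the Taylor terms of order at most \<open>e\<close> drop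
    out.\<close>
  have low: "\<phi> ([:- c, 1:] ^ (d - j)) = 0" if "j \<le> e" for j
  proof -
    have "[:- c, 1:] ^ (d - j) = [:- c, 1:] ^ (d - e) * [:- c, 1:] ^ (e - j)"
      using that e by (simp flip: power_add)
    then show ?thesis using zero[of "[:- c, 1:] ^ (e - j)"] by (simp add: degree_linear_power)
  qed
  \<comment> \<open>The surviving Taylor terms in \<open>s = x - c\<close>, divided by
    \<open>s ^ Suc e\<close>.\<close>
  define K where "K = (\<Sum>j\<in>{Suc e..d}. monom (of_nat (d choose j) * (- 1) ^ j * \<phi> ([:- c, 1:] ^ (d - j))) (j - Suc e))"
  have "poly H x = poly ([:- c, 1:] ^ Suc e * pcompose K [:- c, 1:]) x" for x
  proof -
    define s where "s = x - c"
    have "poly H x = (\<Sum>j\<le>d. of_nat (d choose j) * (- s) ^ j * \<phi> ([:- c, 1:] ^ (d - j)))"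
      unfolding H using linear_power_expand[of c s d] by (simp add: s_def sum smult)
    also have "\<dots> = (\<Sum>j\<in>{Suc e..d}. of_nat (d choose j) * (- s) ^ j * \<phi> ([:- c, 1:] ^ (d - j)))"
      by (rule sum.mono_neutral_right) (auto simp: low not_less_eq_eq)
    also have "\<dots> = s ^ Suc e * poly K s"
      unfolding K_def poly_sum poly_monom sum_distrib_left
    proof (rule sum.cong)
      fix j
      assume "j \<in> {Suc e..d}"
      have regroup: "u * v = t \<Longrightarrow> a * (b * t) * f = u * (a * b * f * v)" for u v t a b f :: complex
        by auto
      have "s ^ Suc e * s ^ (j - Suc e) = s ^ j"
        using \<open>j \<in> {Suc e..d}\<close> by (simp flip: power_add del: power_Suc)
      then show "of_nat (d choose j) * (- s) ^ j * \<phi> ([:- c, 1:] ^ (d - j)) =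
         s ^ Suc e * (of_nat (d choose j) * (- 1) ^ j * \<phi> ([:- c, 1:] ^ (d - j)) * s ^ (j - Suc e))"
        unfolding power_minus[of s j] by (rule regroup)
    qed simp
    finally show ?thesis by (simp add: s_def poly_pcompose del: power_Suc)
  qed
  then have "H = [:- c, 1:] ^ Suc e * pcompose K [:- c, 1:]"
    using poly_eq_poly_eq_iff by blast
  then show ?thesis by (rule dvdI)
qed

lemma sum_le_degree_if_roots:
  fixes H :: "complex poly"
  assumes "H \<noteq> 0" "finite X" "\<And>x. x \<in> X \<Longrightarrow> [:- x, 1:] ^ \<mu> x dvd H" "\<And>x. x \<in> X \<Longrightarrow> \<mu> x > 0"
  shows "(\<Sum>x\<in>X. \<mu> x) \<le> degree H"
proof -
  have le: "\<mu> x \<le> order x H" if "x \<in> X" for x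
    using assms that by (simp add: order_divides)
  then have "(\<Sum>x\<in>X. \<mu> x) \<le> (\<Sum>x\<in>X. order x H)"
    by (rule sum_mono)
  also have "\<dots> \<le> (\<Sum>x | poly H x = 0. order x H)"
  proof (rule sum_mono2)
    show "X \<subseteq> {x. poly H x = 0}"
      using le assms(1,4) order_root by fastforce
  qed (use assms poly_roots_finite in auto)
  also have "\<dots> \<le> degree H" by (rule sum_order_le_degree) fact
  finally show ?thesis .
qed

lemma coeff_sum_monom: "coeff (\<Sum>i\<le>d. monom (f i) i) k = (if k \<le> d then f k else 0)"
  by (simp add: coeff_sum)

lemma degree_sum_monom_le: "degree (\<Sum>i\<le>d. monom (f i) i) \<le> d"
  by (rule degree_le) (simp add: coeff_sum_monom)

text \<open>The zeros of the apolar form are counted on the projective line. A form with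
  \<open>L j 1 = 0\<close> becomes a constant at \<open>y = 1\<close>; its zero lies at infinity and
  shows up as a vanishing coefficient of degree \<open>d\<close> in \<open>H\<close>.\<close>

lemma powers_span:
  fixes c :: "nat \<Rightarrow> complex" and L :: "nat \<Rightarrow> nat \<Rightarrow> complex"
  assumes d: "d \<ge> 1"
    and count: "m + (\<Sum>k<r. e k + 1) = d + 1"
    and nonzero: "\<And>j. j < m \<Longrightarrow> L j 0 \<noteq> 0 \<or> L j 1 \<noteq> 0"
    and nonprop: "\<And>j k. j < m \<Longrightarrow> k < m \<Longrightarrow> j \<noteq> k \<Longrightarrow> L j 0 * L k 1 \<noteq> L k 0 * L j 1"
    and e: "\<And>k. k < r \<Longrightarrow> e k \<le> d"
    and inj: "inj_on c {..<r}"
    and c: "\<And>j k. j < m \<Longrightarrow> k < r \<Longrightarrow> L j 1 \<noteq> 0 \<Longrightarrow> c k \<noteq> - L j 0 / L j 1"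
    and p: "degree p \<le> d"
  shows "\<exists>\<tau> g. (\<forall>k<r. degree (g k) \<le> e k) \<and>
    p = (\<Sum>j<m. smult (\<tau> j) ([:L j 0, L j 1:] ^ d)) + (\<Sum>k<r. [:- c k, 1:] ^ (d - e k) * g k)"
proof -
  define G where "G = (\<lambda>\<tau> g. (\<Sum>j<m. smult (\<tau> j) ([:L j 0, L j 1:] ^ d)) + (\<Sum>k<r. [:- c k, 1:] ^ (d - e k) * g k))"
  define S where "S = {G \<tau> g | \<tau> g. \<forall>k<r. degree (g k) \<le> e k}"
  have "p \<in> S"
  proof (rule ccontr)
    assume "p \<notin> S"
    have SI: "G \<tau> g \<in> S" if "\<And>k. k < r \<Longrightarrow> degree (g k) \<le> e k" for \<tau> g
      using that unfolding S_def by blast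
    have S0: "0 \<in> S"
      using SI[of "\<lambda>k. 0" "\<lambda>j. 0"] by (simp add: G_def)
    have S_add: "p + q \<in> S" if pq: "p \<in> S" "q \<in> S" for p q
    proof -
      obtain \<tau> g where 1: "p = G \<tau> g" "\<And>k. k < r \<Longrightarrow> degree (g k) \<le> e k"
        using pq(1) unfolding S_def by blast
      obtain \<tau>' g' where 2: "q = G \<tau>' g'" "\<And>k. k < r \<Longrightarrow> degree (g' k) \<le> e k"
        using pq(2) unfolding S_def by blast
      have "p + q = G (\<lambda>j. \<tau> j + \<tau>' j) (\<lambda>k. g k + g' k)"
        by (simp add: 1 2 G_def sum.distrib smult_add_left algebra_simps)
      then show ?thesis using SI[of "\<lambda>k. g k + g' k"] 1 2 by (simp add: degree_add_le)
    qed
    have S_smult: "smult x p \<in> S" if pS: "p \<in> S" for x p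
    proof -
      obtain \<tau> g where 1: "p = G \<tau> g" "\<And>k. k < r \<Longrightarrow> degree (g k) \<le> e k"
        using pS unfolding S_def by blast
      have "smult x p = G (\<lambda>j. x * \<tau> j) (\<lambda>k. smult x (g k))"
        by (simp add: 1 G_def smult_add_right smult_sum_right)
      then show ?thesis using SI[of "\<lambda>k. smult x (g k)"] 1 by (simp add: degree_smult_le order_trans)
    qed
    obtain \<phi> where add: "\<And>p q. \<phi> (p + q) = \<phi> p + \<phi> q" and smult: "\<And>c p. \<phi> (smult c p) = c * \<phi> p"
      and \<phi>S: "\<And>q. q \<in> S \<Longrightarrow> \<phi> q = 0" and \<phi>p: "\<phi> p \<noteq> 0"
      using separating_functional[OF S0 S_add S_smult \<open>p \<notin> S\<close>] by blast
    have sum: "\<phi> (\<Sum>j\<in>A. f j) = (\<Sum>j\<in>A. \<phi> (f j))" for A :: "nat set" and f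
      using smult[of 0 0] by (induction A rule: infinite_finite_induct) (simp_all add: add)
    have \<phi>1: "\<phi> ([:L j 0, L j 1:] ^ d) = 0" if "j < m" for j
    proof -
      have "(\<Sum>i<m. smult (if i = j then 1 else 0) ([:L i 0, L i 1:] ^ d)) = [:L j 0, L j 1:] ^ d"
        using that by (subst sum.remove[of _ j]) auto
      then have "G (\<lambda>i. if i = j then 1 else 0) (\<lambda>k. 0) = [:L j 0, L j 1:] ^ d"
        by (simp add: G_def)
      then show ?thesis using \<phi>S SI[of "\<lambda>k. 0" "\<lambda>i. if i = j then 1 else 0"] by simp
    qed
    have \<phi>2: "\<phi> ([:- c k, 1:] ^ (d - e k) * g) = 0" if "k < r" "degree g \<le> e k" for k g
    proof -
      have "(\<Sum>i<r. [:- c i, 1:] ^ (d - e i) * (if i = k then g else 0)) = [:- c k, 1:] ^ (d - e k) * g"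
        using that by (subst sum.remove[of _ k]) auto
      then have "G (\<lambda>j. 0) (\<lambda>i. if i = k then g else 0) = [:- c k, 1:] ^ (d - e k) * g"
        by (simp add: G_def)
      then show ?thesis using \<phi>S SI[of "\<lambda>i. if i = k then g else 0" "\<lambda>j. 0"] that by simp
    qed
    define H where "H = (\<Sum>j\<le>d. monom (of_nat (d choose j) * (- 1) ^ j * \<phi> (monom 1 (d - j))) j)"
    have H: "poly H x = \<phi> ([:- x, 1:] ^ d)" for x
    proof -
      have "[:- x, 1:] ^ d = (\<Sum>j\<le>d. smult (of_nat (d choose j) * (- x) ^ j) (monom 1 (d - j)))"
        using linear_power_expand[of 0 x d] by (simp add: monom_altdef)
      then have "\<phi> ([:- x, 1:] ^ d) = (\<Sum>j\<le>d. of_nat (d choose j) * (- x) ^ j * \<phi> (monom 1 (d - j)))"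
        by (simp add: sum smult)
      also have "\<dots> = poly H x"
        unfolding H_def poly_sum poly_monom
        by (rule sum.cong) (simp_all add: power_minus[of x] mult_ac)
      finally show ?thesis ..
    qed
    \<comment> \<open>The coefficients of \<open>H\<close> are nonzero multiples of the values of
      \<open>\<phi>\<close> on monomials of degree at most \<open>d\<close>. If all were 0, then
      \<open>\<phi>\<close> would kill \<open>p\<close>.\<close>
    have "H \<noteq> 0"
    proof
      assume "H = 0"
      then have *: "\<phi> (monom 1 (d - j)) = 0" if "j \<le> d" for j
        using that coeff_sum_monom[of "\<lambda>j. of_nat (d choose j) * (- 1) ^ j * \<phi> (monom 1 (d - j))" d j]
        by (simp add: H_def)
      have "p = (\<Sum>i\<le>d. smult (coeff p i) (monom 1 i))"
        using poly_as_sum_of_monoms'[OF p] by (simp add: smult_monom)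
      then have "\<phi> p = (\<Sum>i\<le>d. coeff p i * \<phi> (monom 1 i))"
        by (metis (no_types, lifting) sum smult sum.cong)
      also have "\<dots> = 0"
      proof (intro sum.neutral ballI)
        show "coeff p i * \<phi> (monom 1 i) = 0" if "i \<in> {..d}" for i
          using *[of "d - i"] that by simp
      qed
      finally show False using \<phi>p by simp
    qed
    have degH: "degree H \<le> d"
      unfolding H_def by (rule degree_sum_monom_le)
    \<comment> \<open>The roots of those linear forms, indexed by \<open>J\<close>, whose root is
      finite.\<close>
    define b where "b = (\<lambda>j. - L j 0 / L j 1)"
    define J where "J = {j. j < m \<and> L j 1 \<noteq> 0}"
    have injb: "inj_on b J"
    proof (rule inj_onI, rule ccontr)
      fix i j
      assume *: "i \<in> J" "j \<in> J" "b i = b j" "i \<noteq> j"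
      then have "L i 0 * L j 1 = L j 0 * L i 1"
        by (simp add: J_def b_def field_simps)
      with nonprop[of i j] * show False by (simp add: J_def)
    qed
    have root_b: "[:- b j, 1:] ^ Suc 0 dvd H" if "j \<in> J" for j
    proof -
      have "[:L j 0, L j 1:] = smult (L j 1) [:- b j, 1:]"
        using that by (simp add: J_def b_def)
      then have "[:L j 0, L j 1:] ^ d = smult (L j 1 ^ d) ([:- b j, 1:] ^ d)"
        by (simp only: smult_power)
      then have "L j 1 ^ d * \<phi> ([:- b j, 1:] ^ d) = 0"
        using \<phi>1[of j] that smult by (simp add: J_def)
      then have "poly H (b j) = 0" using that by (simp add: H J_def)
      then show ?thesis by (simp add: poly_eq_0_iff_dvd)
    qed
    have root_c: "[:- c k, 1:] ^ Suc (e k) dvd H" if "k < r" for k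
      using that by (intro apolar_root[OF add smult H]) (auto intro: e \<phi>2)
    define \<mu> where "\<mu> = (\<lambda>x. if x \<in> b ` J then Suc 0 else Suc (e (inv_into {..<r} c x)))"
    have disj: "b ` J \<inter> c ` {..<r} = {}"
      using c by (fastforce simp: J_def b_def)
    have finJ: "finite J" by (simp add: J_def)
    have "(\<Sum>x\<in>b ` J \<union> c ` {..<r}. \<mu> x) \<le> degree H"
    proof (rule sum_le_degree_if_roots[OF \<open>H \<noteq> 0\<close>])
      fix x
      assume "x \<in> b ` J \<union> c ` {..<r}"
      then show "[:- x, 1:] ^ \<mu> x dvd H"
        using root_b root_c disj inj by (auto simp: \<mu>_def simp del: power_Suc)
    qed (auto simp: \<mu>_def finJ)
    also have "(\<Sum>x\<in>b ` J \<union> c ` {..<r}. \<mu> x) = (\<Sum>x\<in>b ` J. \<mu> x) + (\<Sum>x\<in>c ` {..<r}. \<mu> x)"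
      using disj finJ by (intro sum.union_disjoint) auto
    also have "(\<Sum>x\<in>b ` J. \<mu> x) = card J"
      using injb by (simp add: \<mu>_def card_image)
    also have "(\<Sum>x\<in>c ` {..<r}. \<mu> x) = (\<Sum>k<r. e k + 1)"
      unfolding sum.reindex[OF inj] using disj inj by (intro sum.cong) (auto simp: \<mu>_def)
    finally have le: "card J + (\<Sum>k<r. e k + 1) \<le> degree H" .
    \<comment> \<open>If no root is at infinity, \<open>H\<close> has \<open>d + 1\<close> zeros but
      degree at most \<open>d\<close>. Otherwise non-proportionality leaves exactly one form at
      infinity; the other \<open>d\<close> zeros force degree exactly \<open>d\<close>, while
      \<open>\<phi> 1 = 0\<close> kills the coefficient of degree \<open>d\<close>.\<close>
    show False
    proof (cases "J = {..<m}")
      case True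
      then show False using le degH count by simp
    next
      case False
      then obtain j where j: "j < m" "L j 1 = 0" by (auto simp: J_def)
      have "J = {..<m} - {j}"
      proof -
        have "L i 1 \<noteq> 0" if "i < m" "i \<noteq> j" for i
          using nonprop[of i j] that j by auto
        then show ?thesis using j by (auto simp: J_def)
      qed
      then have "card J = m - 1" using j by simp
      then have "degree H = d" using le degH count j by linarith
      moreover have "coeff H d = 0"
      proof -
        have "[:L j 0, L j 1:] ^ d = smult (L j 0 ^ d) 1"
          using j by (simp add: poly_const_pow)
        then have "L j 0 ^ d * \<phi> 1 = 0"
          using \<phi>1[OF j(1)] by (simp flip: smult)
        then have "\<phi> 1 = 0" using nonzero[OF j(1)] j by simp
        then show ?thesis
          unfolding H_def coeff_sum_monom by (simp flip: one_pCons add: monom_0)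
      qed
      ultimately show False using \<open>H \<noteq> 0\<close> leading_coeff_0_iff by blast
    qed
  qed
  then show ?thesis unfolding S_def G_def by blast
qed

section \<open>Canonical forms\<close>

text \<open>The dehomogenization of a binary form at \<open>y = 1\<close>.\<close>

definition form_poly :: "nat \<Rightarrow> (nat \<Rightarrow> complex) \<Rightarrow> complex poly" where
  "form_poly d a = (\<Sum>i\<le>d. monom (a i) i)"

definition canonical_poly ::
  "nat \<Rightarrow> nat \<Rightarrow> nat \<Rightarrow> (nat \<Rightarrow> nat \<Rightarrow> complex) \<Rightarrow> (nat \<Rightarrow> nat) \<Rightarrow>
    (nat \<Rightarrow> complex) \<Rightarrow> (nat \<Rightarrow> nat \<Rightarrow> complex) \<Rightarrow> complex poly" where
  "canonical_poly d m r L e t f =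
    (\<Sum>j<m. smult (t j) ([:L j 0, L j 1:] ^ d)) + (\<Sum>k<r. form_poly (e k) (f k) ^ (d div e k))"

lemma coeff_form_poly: "coeff (form_poly d a) i = (if i \<le> d then a i else 0)"
  unfolding form_poly_def by (rule coeff_sum_monom)

lemma degree_form_poly_le: "degree (form_poly d a) \<le> d"
  unfolding form_poly_def by (rule degree_sum_monom_le)

lemma form_poly_coeff: "degree p \<le> d \<Longrightarrow> form_poly d (coeff p) = p"
  unfolding form_poly_def by (rule poly_as_sum_of_monoms')

lemma form_poly_cong: "(\<And>i. i \<le> d \<Longrightarrow> a i = b i) \<Longrightarrow> form_poly d a = form_poly d b"
  unfolding form_poly_def by (intro sum.cong) auto

lemma canonical_poly_cong:
  assumes "\<And>j. j < m \<Longrightarrow> t j = t' j" "\<And>k i. k < r \<Longrightarrow> i \<le> e k \<Longrightarrow> f k i = f' k i"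
  shows "canonical_poly d m r L e t f = canonical_poly d m r L e t' f'"
  unfolding canonical_poly_def using assms
  by (intro arg_cong2[of _ _ _ _ "(+)"] sum.cong arg_cong2[of _ _ _ _ "(^)"] form_poly_cong) auto

lemma form_poly_fam:
  assumes "\<And>i. i \<le> d \<Longrightarrow> (\<lambda>v. f v i) \<in> poly_fun n"
  shows "(\<lambda>v. form_poly d (f v)) \<in> poly_fam n (Suc d)"
proof -
  have "(\<lambda>v. coeff (form_poly d (f v)) i) \<in> poly_fun n" for i
    using assms[of i] by (cases "i \<le> d") (simp_all add: coeff_form_poly poly_fun.const)
  then show ?thesis by (simp add: poly_fam_def coeff_form_poly)
qed

lemma canonical_poly_coeff_poly_fun:
  assumes t: "\<And>j. j < m \<Longrightarrow> (\<lambda>v. t v j) \<in> poly_fun n"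
    and f: "\<And>k i. k < r \<Longrightarrow> i \<le> e k \<Longrightarrow> (\<lambda>v. f v k i) \<in> poly_fun n"
  shows "(\<lambda>v. coeff (canonical_poly d m r L e (t v) (f v)) i) \<in> poly_fun n"
proof -
  have "(\<lambda>v. coeff (form_poly (e k) (f v k) ^ (d div e k)) i) \<in> poly_fun n" if k: "k < r" for k
  proof -
    have "(\<lambda>v. form_poly (e k) (f v k)) \<in> poly_fam n (Suc (e k))"
      by (rule form_poly_fam) (rule f[OF k])
    then obtain E where "(\<lambda>v. form_poly (e k) (f v k) ^ (d div e k)) \<in> poly_fam n E"
      using poly_fam_power by blast
    then show ?thesis by (rule poly_fam_coeff)
  qed
  moreover have "(\<lambda>v. t v j * coeff ([:L j 0, L j 1:] ^ d) i) \<in> poly_fun n" if "j < m" for j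
    by (rule poly_fun.mult[OF t[OF that] poly_fun.const])
  ultimately show ?thesis
    unfolding canonical_poly_def coeff_add coeff_sum coeff_smult
    by (intro poly_fun.add poly_fun_sum) auto
qed

section \<open>Constructibility and density of the set of canonical forms\<close>

text \<open>The graph of the parametrization is cut out by \<open>n\<close> polynomial equations,
  and the set in question is its projection to the first \<open>n\<close> coordinates.\<close>

lemma constructible_canonical_forms:
  assumes e: "\<And>k. k < r \<Longrightarrow> e k < n"
  shows "{a. \<exists>t f. \<forall>i<n. a i = coeff (canonical_poly d m r L e t f) i} \<in> constructible n"
proof -
  \<comment> \<open>Coordinate layout after the first \<open>n\<close>: \<open>m\<close> places for
    \<open>t\<close>, then \<open>r\<close> blocks of length \<open>n\<close>. Since
    \<open>e k < n\<close>, a block has room for the \<open>e k + 1\<close> coefficients of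
    \<open>f k\<close>.\<close>
  define N where "N = m + r * n"
  define T where "T = (\<lambda>(v :: nat \<Rightarrow> complex) j. v (n + j))"
  define F where "F = (\<lambda>(v :: nat \<Rightarrow> complex) k i. v (n + m + (k * n + i)))"
  define C where "C = (\<lambda>v. canonical_poly d m r L e (T v) (F v))"
  define S where "S = (\<Inter>i\<in>{..<n}. {v. v i - coeff (C v) i = 0})"
  have idx: "k * n + i < r * n" if "k < r" "i < n" for k i
  proof -
    have "k * n + i < Suc k * n" using that by simp
    also have "\<dots> \<le> r * n" using that by (intro mult_le_mono1) simp
    finally show ?thesis .
  qed
  have C: "(\<lambda>v. coeff (C v) i) \<in> poly_fun (n + N)" for i
    unfolding C_def
  proof (rule canonical_poly_coeff_poly_fun)
    show "(\<lambda>v. T v j) \<in> poly_fun (n + N)" if "j < m" for j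
      unfolding T_def by (rule poly_fun.coord) (use that in \<open>simp add: N_def\<close>)
    show "(\<lambda>v. F v k i) \<in> poly_fun (n + N)" if "k < r" "i \<le> e k" for k i
      unfolding F_def by (rule poly_fun.coord) (use idx[of k i] e[of k] that in \<open>simp add: N_def\<close>)
  qed
  have "S \<in> constructible (n + N)"
    unfolding S_def
  proof (intro constructible_Inter constructible.zero_set poly_fun_diff C)
    show "(\<lambda>v. v i) \<in> poly_fun (n + N)" if "i \<in> {..<n}" for i
      using that by (intro poly_fun.coord) simp
  qed simp
  from constructible_project_many[OF this]
  have "{a. \<exists>b. (\<lambda>i. if i < n then a i else b i) \<in> S} \<in> constructible n" .
  also have "{a. \<exists>b. (\<lambda>i. if i < n then a i else b i) \<in> S}
      = {a. \<exists>t f. \<forall>i<n. a i = coeff (canonical_poly d m r L e t f) i}"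
  proof (intro Collect_cong iffI)
    fix a
    assume "\<exists>b. (\<lambda>i. if i < n then a i else b i) \<in> S"
    then obtain b where "(\<lambda>i. if i < n then a i else b i) \<in> S" by blast
    then have "\<forall>i<n. a i = coeff (C (\<lambda>i. if i < n then a i else b i)) i"
      by (auto simp: S_def)
    then show "\<exists>t f. \<forall>i<n. a i = coeff (canonical_poly d m r L e t f) i"
      unfolding C_def by blast
  next
    fix a
    assume "\<exists>t f. \<forall>i<n. a i = coeff (canonical_poly d m r L e t f) i"
    then obtain t f where tf: "\<And>i. i < n \<Longrightarrow> a i = coeff (canonical_poly d m r L e t f) i" by blast
    define b where "b = (\<lambda>x. if x < n + m then t (x - n) else f ((x - (n + m)) div n) ((x - (n + m)) mod n))"
    define v where "v = (\<lambda>i. if i < n then a i else b i)"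
    have "C v = canonical_poly d m r L e t f"
      unfolding C_def
    proof (rule canonical_poly_cong)
      show "T v j = t j" if "j < m" for j
        using that by (simp add: T_def v_def b_def)
      show "F v k i = f k i" if "k < r" "i \<le> e k" for k i
        using that e[of k] by (simp add: F_def v_def b_def)
    qed
    then have "v \<in> S"
      using tf by (simp add: S_def v_def)
    then show "\<exists>b. (\<lambda>i. if i < n then a i else b i) \<in> S"
      unfolding v_def by blast
  qed
  finally show ?thesis .
qed

text \<open>By \<open>powers_span\<close> the differential of the parametrization is onto at
  \<open>t = 0\<close> and \<open>f k\<close> a power of a general linear form. So every velocity
  occurs for a curve inside the image, on which \<open>h\<close> vanishes.\<close>

lemma canonical_forms_dense:
  fixes L :: "nat \<Rightarrow> nat \<Rightarrow> complex"
  assumes d: "d \<ge> 1"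
    and count: "m + (\<Sum>k<r. e k + 1) = d + 1"
    and nonzero: "\<And>j. j < m \<Longrightarrow> L j 0 \<noteq> 0 \<or> L j 1 \<noteq> 0"
    and nonprop: "\<And>j k. j < m \<Longrightarrow> k < m \<Longrightarrow> j \<noteq> k \<Longrightarrow> L j 0 * L k 1 \<noteq> L k 0 * L j 1"
    and e: "\<And>k. k < r \<Longrightarrow> e k > 0" "\<And>k. k < r \<Longrightarrow> e k dvd d"
    and h: "h \<in> poly_fun (Suc d)"
    and zero: "\<And>t f a. (\<And>i. i \<le> d \<Longrightarrow> a i = coeff (canonical_poly d m r L e t f) i) \<Longrightarrow> h a = 0"
  shows "h a = 0"
proof -
  \<comment> \<open>The linear forms \<open>X - c k\<close> need distinct roots away from those of
    the given forms. For \<open>L j 1 = 0\<close> the quotient is 0 by convention, and 0 is then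
    avoided as well.\<close>
  have "infinite (- (\<lambda>j. - L j 0 / L j 1) ` {..<m})"
    by (simp add: Compl_eq_Diff_UNIV Diff_infinite_finite infinite_UNIV_char_0)
  then obtain c :: "nat \<Rightarrow> complex" where c: "inj c" "range c \<subseteq> - (\<lambda>j. - L j 0 / L j 1) ` {..<m}"
    using infinite_countable_subset by blast
  have e_le: "e k \<le> d" if "k < r" for k
    using e[OF that] d by (auto intro: dvd_imp_le)
  define l where "l = (\<lambda>k. [:- c k, 1:])"
  define f0 where "f0 = (\<lambda>k. coeff (l k ^ e k))"
  define y0 where "y0 = coeff (canonical_poly d m r L e (\<lambda>j. 0) f0)"
  have deg_l: "degree (l k ^ i) = i" for k i
    by (simp add: l_def degree_linear_power)
  show ?thesis
  proof (rule poly_fun_eq_0_if_all_velocities[OF h, of y0])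
    fix z :: "nat \<Rightarrow> complex"
    obtain \<tau> g where g: "\<And>k. k < r \<Longrightarrow> degree (g k) \<le> e k"
      and z: "form_poly d z = (\<Sum>j<m. smult (\<tau> j) ([:L j 0, L j 1:] ^ d)) + (\<Sum>k<r. l k ^ (d - e k) * g k)"
    proof -
      have ck: "c k \<noteq> - L j 0 / L j 1" if "j < m" for j k
        using c(2) that by auto
      have "inj_on c {..<r}" using c(1) by (rule inj_on_subset) simp
      from powers_span[where L = L and c = c, OF d count nonzero nonprop e_le this ck degree_form_poly_le]
      show ?thesis using that unfolding l_def by blast
    qed
    \<comment> \<open>The scaling cancels the factor \<open>d div e k\<close> that differentiating
      the power produces.\<close>
    define g' where "g' = (\<lambda>k. smult (inverse (of_nat (d div e k))) (g k))"
    define t where "t = (\<lambda>s j. s * \<tau> j)"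
    define f where "f = (\<lambda>s k. coeff (l k ^ e k + smult s (g' k)))"
    define y where "y = (\<lambda>s. coeff (canonical_poly d m r L e (t s) (f s)))"
    have form: "form_poly (e k) (f s k) = l k ^ e k + smult s (g' k)" if "k < r" for s k
      unfolding f_def using g[OF that]
      by (intro form_poly_coeff degree_add_le) (auto simp: g'_def deg_l intro: order_trans[OF degree_smult_le])
    \<comment> \<open>The summand \<open>0 +\<close> brings the linear part into the shape of
      \<open>coeff_deriv_line\<close>.\<close>
    have "canonical_poly d m r L e (t s) (f s)
       = (\<Sum>j<m. 0 + smult s (smult (\<tau> j) ([:L j 0, L j 1:] ^ d)))
         + (\<Sum>k<r. (l k ^ e k + smult s (g' k)) ^ (d div e k))" for s
      unfolding canonical_poly_def by (simp add: form t_def)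
    moreover have "coeff_deriv (\<lambda>s. (\<Sum>j<m. 0 + smult s (smult (\<tau> j) ([:L j 0, L j 1:] ^ d)))
         + (\<Sum>k<r. (l k ^ e k + smult s (g' k)) ^ (d div e k))) (form_poly d z)"
      unfolding z
    proof (intro coeff_deriv_add coeff_deriv_sum coeff_deriv_line)
      fix k
      assume "k \<in> {..<r}"
      then have k: "e k > 0" "e k dvd d" "e k \<le> d" using e e_le by auto
      then have nz: "d div e k \<noteq> 0" by (simp add: div_eq_0_iff)
      have "e k * (d div e k - 1) = d - e k"
        using k by (simp add: right_diff_distrib')
      then have "of_nat (d div e k) * (l k ^ e k) ^ (d div e k - 1) * g' k = l k ^ (d - e k) * g k"
        using nz by (simp add: g'_def of_nat_poly flip: power_mult)
      with coeff_deriv_power[OF coeff_deriv_line[of "l k ^ e k" "g' k"], of "d div e k"]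
      show "coeff_deriv (\<lambda>s. (l k ^ e k + smult s (g' k)) ^ (d div e k)) (l k ^ (d - e k) * g k)"
        by simp
    qed
    ultimately have "coeff_deriv (\<lambda>s. canonical_poly d m r L e (t s) (f s)) (form_poly d z)"
      by simp
    then have "((\<lambda>s. y s i) has_field_derivative z i) (at 0)" if "i < Suc d" for i
      using that unfolding coeff_deriv_def y_def by (auto simp: coeff_form_poly dest: spec[of _ i])
    moreover have "y 0 = y0"
      by (simp add: y_def y0_def t_def f_def f0_def)
    moreover have "h (y s) = 0" for s
      by (rule zero[of _ "t s" "f s"]) (simp add: y_def)
    ultimately show "\<exists>y. y 0 = y0 \<and> (\<forall>s. h (y s) = 0) \<and>
        (\<forall>i<Suc d. ((\<lambda>s. y s i) has_field_derivative z i) (at 0))"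
      by blast
  qed
qed

section \<open>Passage back to binary forms\<close>

lemma bform_eq_form_poly:
  assumes "y \<noteq> 0"
  shows "bform d a x y = y ^ d * poly (form_poly d a) (x / y)"
proof -
  have "x ^ i * y ^ (d - i) = y ^ d * (x / y) ^ i" if "i \<le> d" for i
    using assms that by (simp add: power_divide power_diff)
  then show ?thesis
    unfolding bform_def form_poly_def poly_sum poly_monom sum_distrib_left
    by (intro sum.cong) (simp_all add: mult.assoc mult.left_commute)
qed

lemma form_poly_1: "form_poly 1 a = [:a 0, a 1:]"
  by (auto simp: poly_eq_iff coeff_form_poly coeff_pCons split: nat.split)

text \<open>With this bound, agreement of the coefficients up to \<open>d\<close> determines the
  whole polynomial.\<close>

lemma degree_canonical_poly_le:
  assumes "\<And>k. k < r \<Longrightarrow> e k dvd d"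
  shows "degree (canonical_poly d m r L e t f) \<le> d"
proof -
  have "degree (smult (t j) ([:L j 0, L j 1:] ^ d)) \<le> d" for j
    using degree_power_le[of "[:L j 0, L j 1:]" d]
    by (intro order_trans[OF degree_smult_le]) (simp split: if_splits)
  moreover have "degree (form_poly (e k) (f k) ^ (d div e k)) \<le> d" if "k < r" for k
  proof -
    have "degree (form_poly (e k) (f k) ^ (d div e k)) \<le> e k * (d div e k)"
      using degree_power_le[of "form_poly (e k) (f k)" "d div e k"] degree_form_poly_le[of "e k" "f k"]
      by (meson mult_le_mono1 order_trans)
    then show ?thesis using assms[OF that] by simp
  qed
  ultimately show ?thesis
    unfolding canonical_poly_def by (intro degree_add_le degree_sum_le) auto
qed

text \<open>The case \<open>y = 0\<close>, where dehomogenization is unavailable, follows by continuity.\<close>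

lemma bform_canonical:
  assumes e: "\<And>k. k < r \<Longrightarrow> e k dvd d"
    and a: "\<And>i. i \<le> d \<Longrightarrow> a i = coeff (canonical_poly d m r L e t f) i"
  shows "bform d a x y = (\<Sum>j<m. t j * bform 1 (L j) x y ^ d) + (\<Sum>k<r. bform (e k) (f k) x y ^ (d div e k))"
proof -
  define R where "R = (\<lambda>y. (\<Sum>j<m. t j * bform 1 (L j) x y ^ d) + (\<Sum>k<r. bform (e k) (f k) x y ^ (d div e k)))"
  have eq: "bform d a x y = R y" if y: "y \<noteq> 0" for y
  proof -
    have "form_poly d a = form_poly d (coeff (canonical_poly d m r L e t f))"
      using a by (rule form_poly_cong)
    also have "\<dots> = canonical_poly d m r L e t f"
      by (intro form_poly_coeff degree_canonical_poly_le e)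
    finally have "bform d a x y = y ^ d * poly (canonical_poly d m r L e t f) (x / y)"
      using bform_eq_form_poly[OF y] by simp
    also have "\<dots> = (\<Sum>j<m. y ^ d * (t j * poly [:L j 0, L j 1:] (x / y) ^ d)) +
        (\<Sum>k<r. y ^ d * poly (form_poly (e k) (f k)) (x / y) ^ (d div e k))"
      by (simp add: canonical_poly_def poly_sum distrib_left sum_distrib_left del: poly_pCons)
    also have "\<dots> = R y"
      unfolding R_def
    proof (intro arg_cong2[of _ _ _ _ "(+)"] sum.cong refl)
      show "y ^ d * (t j * poly [:L j 0, L j 1:] (x / y) ^ d) = t j * bform 1 (L j) x y ^ d" for j
        unfolding bform_eq_form_poly[OF y] form_poly_1 by (simp add: power_mult_distrib del: poly_pCons)
      fix k
      assume "k \<in> {..<r}"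
      then have "e k * (d div e k) = d" using e by simp
      then show "y ^ d * poly (form_poly (e k) (f k)) (x / y) ^ (d div e k) = bform (e k) (f k) x y ^ (d div e k)"
        unfolding bform_eq_form_poly[OF y] by (simp add: power_mult_distrib flip: power_mult)
    qed
    finally show ?thesis .
  qed
  have "bform d a x y = R y"
  proof (cases "y = 0")
    case True
    have "(\<lambda>y. bform d a x y) \<midarrow>0\<rightarrow> bform d a x 0" "R \<midarrow>0\<rightarrow> R 0"
      unfolding R_def bform_def by (intro tendsto_intros)+
    moreover have "(\<lambda>y. bform d a x y) \<midarrow>0\<rightarrow> R 0 \<longleftrightarrow> R \<midarrow>0\<rightarrow> R 0"
      by (rule LIM_equal) (simp add: eq)
    ultimately show ?thesis using LIM_unique True by blast
  qed (rule eq)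
  then show ?thesis by (simp add: R_def)
qed

lemma bform_truncate: "bform d (\<lambda>i. if i \<le> d then a i else 0) = bform d a"
  unfolding bform_def by (intro ext sum.cong) auto

lemma bform_1: "bform 1 a = (\<lambda>x y. a 0 * y + a 1 * x)"
  by (simp add: bform_def fun_eq_iff)

theorem theorem1p6:
  fixes d m r :: nat and L :: "nat \<Rightarrow> nat \<Rightarrow> complex" and e :: "nat \<Rightarrow> nat"
  assumes "d \<ge> 1"
    and "\<And>j. j < m \<Longrightarrow> L j \<in> coeff_space 1"
    and "\<And>j. j < m \<Longrightarrow> bform 1 (L j) \<noteq> (\<lambda>x y. 0)"
    and "\<And>j k. j < m \<Longrightarrow> k < m \<Longrightarrow> j \<noteq> k \<Longrightarrow>
           \<not> (\<exists>c. bform 1 (L j) = (\<lambda>x y. c * bform 1 (L k) x y))"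
    and "\<And>k. k < r \<Longrightarrow> e k > 0"
    and "\<And>k. k < r \<Longrightarrow> e k dvd d"
    and "r > 0 \<Longrightarrow> d > e 0"
    and "\<And>k. Suc k < r \<Longrightarrow> e k \<ge> e (Suc k)"
    and "m + (\<Sum>k<r. e k + 1) = d + 1"
  shows "general_form d (\<lambda>a. \<exists>(t :: nat \<Rightarrow> complex) (f :: nat \<Rightarrow> nat \<Rightarrow> complex).
            (\<forall>k<r. f k \<in> coeff_space (e k)) \<and>
            (\<forall>x y. bform d a x y =
               (\<Sum>j<m. t j * (bform 1 (L j) x y) ^ d) +
               (\<Sum>k<r. (bform (e k) (f k) x y) ^ (d div e k))))"
proof -
  note L_nonzero = assms(3) and nonprop = assms(4) and e = assms(5,6) and count = assms(9)
  let ?C = "canonical_poly d m r L e"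
  define A where "A = {a. \<exists>t f. \<forall>i<Suc d. a i = coeff (?C t f) i}"
  have L_coeffs: "L j 0 \<noteq> 0 \<or> L j 1 \<noteq> 0" if "j < m" for j
    using L_nonzero[OF that] unfolding bform_1 by auto
  have L_det: "L j 0 * L k 1 \<noteq> L k 0 * L j 1" if jk: "j < m" "k < m" "j \<noteq> k" for j k
  proof
    assume det: "L j 0 * L k 1 = L k 0 * L j 1"
    \<comment> \<open>The ratio is taken in a coordinate where \<open>L k\<close> is nonzero; the
      vanishing determinant yields the other coordinate.\<close>
    define c where "c = (if L k 1 = 0 then L j 0 / L k 0 else L j 1 / L k 1)"
    have "L j 0 = c * L k 0" "L j 1 = c * L k 1"
      using det L_coeffs[OF jk(2)] by (auto simp: c_def field_simps)
    then have "bform 1 (L j) = (\<lambda>x y. c * bform 1 (L k) x y)"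
      unfolding bform_1 by (simp add: algebra_simps)
    then show False using nonprop[OF jk] by blast
  qed
  have "A \<in> constructible (Suc d)"
    unfolding A_def
  proof (rule constructible_canonical_forms)
    show "e k < Suc d" if "k < r" for k
      using e(2)[OF that] assms(1) by (simp add: dvd_imp_le le_imp_less_Suc)
  qed
  moreover have "\<not> generic (Suc d) (- A)"
  proof
    assume "generic (Suc d) (- A)"
    then obtain h b where h: "h \<in> poly_fun (Suc d)" "h b \<noteq> 0" "\<And>a. h a \<noteq> 0 \<Longrightarrow> a \<notin> A"
      unfolding generic_def by blast
    have "h b = 0"
    proof (rule canonical_forms_dense[OF assms(1) count L_coeffs L_det e h(1)])
      show "h a = 0" if "\<And>i. i \<le> d \<Longrightarrow> a i = coeff (?C t f) i" for t f a
        using h(3)[of a] that by (auto simp: A_def less_Suc_eq_le)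
    qed
    then show False using h(2) by simp
  qed
  \<comment> \<open>Density excludes a generic complement, so by the dichotomy the image
    \<open>A\<close> itself is generic.\<close>
  ultimately obtain g b where g: "g \<in> poly_fun (Suc d)" "g b \<noteq> 0" "\<And>a. g a \<noteq> 0 \<Longrightarrow> a \<in> A"
    using constructible_generic_or_compl unfolding generic_def by blast
  define U where "U = {a \<in> coeff_space d. g a \<noteq> 0}"
  have "zariski_open_forms d U"
    unfolding zariski_open_forms_def U_def using g(1) by (intro conjI exI[of _ "{g}"]) auto
  moreover have "U \<noteq> {}"
  proof -
    \<comment> \<open>The point \<open>b\<close> may have nonzero entries beyond \<open>d\<close>;
      cutting them off moves it into \<open>coeff_space d\<close> without changing
      \<open>g\<close>.\<close>
    have "g (\<lambda>i. if i \<le> d then b i else 0) = g b"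
      by (rule poly_fun_cong[OF g(1)]) simp
    then have "(\<lambda>i. if i \<le> d then b i else 0) \<in> U"
      using g(2) by (simp add: U_def coeff_space_def)
    then show ?thesis by blast
  qed
  moreover have "\<exists>t f. (\<forall>k<r. f k \<in> coeff_space (e k)) \<and>
      (\<forall>x y. bform d a x y = (\<Sum>j<m. t j * bform 1 (L j) x y ^ d)
         + (\<Sum>k<r. bform (e k) (f k) x y ^ (d div e k)))" if "a \<in> U" for a
  proof -
    have "a \<in> A" using that g(3) by (simp add: U_def)
    then obtain t f where tf: "\<And>i. i \<le> d \<Longrightarrow> a i = coeff (?C t f) i"
      by (auto simp: A_def less_Suc_eq_le)
    define f' where "f' = (\<lambda>k i. if i \<le> e k then f k i else 0)"
    have "\<forall>k<r. f' k \<in> coeff_space (e k)"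
      by (simp add: f'_def coeff_space_def)
    moreover have "bform (e k) (f' k) = bform (e k) (f k)" for k
      unfolding f'_def by (rule bform_truncate)
    ultimately show ?thesis
      using bform_canonical[OF e(2) tf] by (intro exI[of _ t] exI[of _ f']) simp
  qed
  ultimately show ?thesis
    unfolding general_form_def by blast
qed

end
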